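(* Let $(G,\cdot)$ be a semigroup with identity element $1$ and let $(\mathbb{F},+,\cdot)$ be a field. If the functions $f,\alpha\colon G\to\mathbb{F}$ satisfy \[ f(xy)-f(x)f(y)=\alpha(xy)\qquad\text{for all } x,y\in G, \] then there exists an exponential function $m\colon G\to\mathbb{F}$ such that \[ f(x)=f(1)\cdot m(x)\qquad\text{and}\qquad \alpha(x)=f(1)(1-f(1))\cdot m(x) \] for all $x\in G$.
   Context: A function $m\colon G\to\mathbb{F}$ is exponential if $m(xy)=m(x)m(y)$ for all $x,y\in G$ (the identically zero function is allowed). *)

theory Defs
  imports Main
begin

text \<open>No condition on the value at the identity is imposed, so the zero function is exponential.\<close>

definition exponential :: "('g::semigroup_mult \<Rightarrow> 'f::field) \<Rightarrow> bool" where
  "exponential m \<longleftrightarrow> (\<forall>x y. m (x * y) = m x * m y)"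

end

theory Submission
  imports Defs
begin

text \<open>Putting y = 1 gives \<alpha> = (1 - f(1)) f. Substituted back, f(xy) cancels and leaves
  f(1) f(xy) = f(x) f(y), so f / f(1) is multiplicative if f(1) is nonzero.\<close>

theorem proposition4:
  fixes f \<alpha> :: "'g::monoid_mult \<Rightarrow> 'f::field"
  assumes "\<And>x y. f (x * y) - f x * f y = \<alpha> (x * y)"
  shows "\<exists>m. exponential m \<and>
    (\<forall>x. f x = f 1 * m x \<and> \<alpha> x = f 1 * (1 - f 1) * m x)"
proof -
  have \<alpha>: "\<alpha> x = f x * (1 - f 1)" for x
    using assms[of x 1] by (simp add: algebra_simps)
  have mult: "f 1 * f (x * y) = f x * f y" for x y
    using assms[of x y] by (simp add: \<alpha> algebra_simps)
  \<comment> \<open>With y = x, \<open>mult\<close> becomes 0 = f(x)^2, and a field has no zero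
    divisors.\<close>
  have zero: "f x = 0" if "f 1 = 0" for x
    using mult[of x x] that by simp
  \<comment> \<open>If \<open>f 1 = 0\<close> then \<open>f = 0\<close>, and division by zero makes \<open>m\<close> the zero function.\<close>
  define m where "m x = f x / f 1" for x
  have f: "f x = f 1 * m x" for x
    using zero by (cases "f 1 = 0") (simp_all add: m_def)
  have "exponential m"
    unfolding exponential_def
  proof (intro allI)
    fix x y
    \<comment> \<open>For nonzero \<open>f 1\<close> this is \<open>mult\<close> divided by
      f(1)^2.\<close>
    show "m (x * y) = m x * m y"
      using mult[of x y] by (cases "f 1 = 0") (simp_all add: m_def field_simps)
  qed
  moreover have "\<alpha> x = f 1 * (1 - f 1) * m x" for x
    using \<alpha>[of x] f[of x] by (metis mult.assoc mult.commute)
  ultimately show ?thesis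
    using f by blast
qed

end
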